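(* Let $a>1$, $m$, $s$, $k$ be positive integers, let $r=2ams-1$, and set \[ D:=m\left(m\left(s+ar^k\right)^2-2r^k\right). \] Define $b_1,\dots,b_{3k}$ by $b_{3j+1}=1$, $b_{3j+2}=ar^j-1$, $b_{3j+3}=2amr^{k-1-j}-1$ for $0\le j\le k-1$ (so the sequence is $1,a-1,2amr^{k-1}-1,\ 1,ar-1,2amr^{k-2}-1,\dots,1,ar^{k-1}-1,2am-1$). Then $l(D)=6k+4$ and \[ \sqrt D=[m(s+ar^k)-1;\overline{b_1,\dots,b_{3k},\,1,\,s+ar^k-2,\,1,\,b_{3k},\dots,b_1,\,2m(s+ar^k)-2}]. \]
   Context: For a positive non-square integer $D$, $l(D)$ denotes the length of the fundamental (shortest) period of the regular continued fraction expansion of $\sqrt D$. $[a_0;\overline{b_1,\dots,b_m}]$ denotes the regular continued fraction whose partial quotients after $a_0$ are the block $b_1,\dots,b_m$ repeated infinitely often. *)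

theory Defs
  imports Complex_Main
begin

text \<open>The finite continued fraction \<open>[c 0; c 1, \<dots>, c n]\<close>.\<close>

primrec cf_convergent :: "(nat \<Rightarrow> int) \<Rightarrow> nat \<Rightarrow> real" where
  "cf_convergent c 0 = of_int (c 0)"
| "cf_convergent c (Suc n) = of_int (c 0) + 1 / cf_convergent (\<lambda>i. c (Suc i)) n"

text \<open>\<open>has_regular_cf x c\<close> means \<open>x = [c 0; c 1, c 2, \<dots>]\<close> as an infinite regular
  continued fraction. For irrational \<open>x\<close> there is exactly one such \<open>c\<close>, for rational \<open>x\<close> none.\<close>

definition has_regular_cf :: "real \<Rightarrow> (nat \<Rightarrow> int) \<Rightarrow> bool" where
  "has_regular_cf x c \<longleftrightarrow> (\<forall>n\<ge>1. c n > 0) \<and> cf_convergent c \<longlonglongrightarrow> x"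

definition periodic_cf :: "int \<Rightarrow> int list \<Rightarrow> nat \<Rightarrow> int" where
  "periodic_cf a0 bs n = (if n = 0 then a0 else bs ! ((n - 1) mod length bs))"

text \<open>Only meaningful when \<open>D\<close> is positive and not a perfect square; the expansion \<open>c\<close>
  of \<open>sqrt D\<close> is then unique and eventually periodic.\<close>

definition cf_period_length :: "int \<Rightarrow> nat" where
  "cf_period_length D = (LEAST p. p > 0 \<and>
     (\<exists>c. has_regular_cf (sqrt (of_int D)) c \<and> (\<exists>N. \<forall>n\<ge>N. c (n + p) = c n)))"

end

theory Submission imports Defs begin

text \<open>
  The complete quotients of \<open>sqrt D\<close> are explicit. Put \<open>A = s + a * r ^ k\<close>, \<open>\<rho> = r ^ j\<close>
  and \<open>\<sigma> = r ^ (k - j)\<close>. In the first half of the period they run through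
  \<open>(m * A - \<rho> + sqrt D) / (2 * m * A - \<rho> - 2 * m * \<sigma>)\<close>,
  \<open>(m * A - 2 * m * \<sigma> + sqrt D) / (2 * m * \<sigma>)\<close> and
  \<open>(m * (a * r ^ k - s) + sqrt D) / (r * \<rho>)\<close>; in the second half the same surds occur in
  reverse order with shifted denominators. As \<open>2 * m * A - 2\<close> exceeds all other partial
  quotients in the block, it occurs exactly once there, so that no shorter period is possible.
\<close>

section \<open>Infinite regular continued fractions\<close>

lemma cf_convergent_ge:
  assumes "\<And>n. n \<ge> 1 \<Longrightarrow> c n > 0"
  shows "real_of_int (c 0) \<le> cf_convergent c n"
  using assms
proof (induction n arbitrary: c)
  case (Suc n)
  have "real_of_int (c (Suc 0)) \<le> cf_convergent (\<lambda>i. c (Suc i)) n"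
    using Suc.IH[of "\<lambda>i. c (Suc i)"] Suc.prems by simp
  moreover have "real_of_int (c (Suc 0)) > 0"
    using Suc.prems by simp
  ultimately show ?case by simp
qed simp

lemma cf_convergent_tail_ge_1:
  assumes "\<And>n. n \<ge> 1 \<Longrightarrow> c n > 0"
  shows "cf_convergent (\<lambda>i. c (Suc i)) n \<ge> 1"
proof -
  have "real_of_int (c (Suc 0)) \<le> cf_convergent (\<lambda>i. c (Suc i)) n"
    using cf_convergent_ge[of "\<lambda>i. c (Suc i)"] assms by simp
  moreover have "real_of_int (c (Suc 0)) \<ge> 1"
    using assms[of "Suc 0"] by simp
  ultimately show ?thesis by linarith
qed

lemma cf_convergent_le:
  assumes "\<And>n. n \<ge> 1 \<Longrightarrow> c n > 0"
  shows "cf_convergent c n \<le> real_of_int (c 0) + 1"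
proof (cases n)
  case (Suc n')
  have "1 / cf_convergent (\<lambda>i. c (Suc i)) n' \<le> 1"
    using cf_convergent_tail_ge_1[of c n'] assms by simp
  then show ?thesis using Suc by simp
qed simp

text \<open>The tail convergents lie between 1 and \<open>c 1 + 1\<close>, so their reciprocals stay
  away from 0. Hence \<open>x - c 0 > 0\<close>, and inversion passes to the limit.\<close>

lemma has_regular_cf_tail:
  assumes "has_regular_cf x c"
  obtains y where "y \<ge> 1" "x = of_int (c 0) + 1 / y" "has_regular_cf y (\<lambda>i. c (Suc i))"
proof -
  let ?t = "cf_convergent (\<lambda>i. c (Suc i))"
  have pos: "\<And>n. n \<ge> 1 \<Longrightarrow> c n > 0" and lim: "cf_convergent c \<longlonglongrightarrow> x"
    using assms by (auto simp: has_regular_cf_def)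
  have t1: "?t n \<ge> 1" for n
    using cf_convergent_tail_ge_1 pos by blast
  have t2: "?t n \<le> of_int (c 1) + 1" for n
    using cf_convergent_le[of "\<lambda>i. c (Suc i)" n] pos by simp
  have "(\<lambda>n. cf_convergent c (Suc n)) \<longlonglongrightarrow> x"
    using lim by (rule LIMSEQ_Suc)
  then have l1: "(\<lambda>n. 1 / ?t n) \<longlonglongrightarrow> x - of_int (c 0)"
    using tendsto_diff[OF _ tendsto_const[of "of_int (c 0)"]] by fastforce
  have "1 / ?t n \<ge> 1 / (of_int (c 1) + 1)" for n
    using t1[of n] t2[of n] by (intro divide_left_mono) (auto intro!: mult_pos_pos)
  then have "x - of_int (c 0) \<ge> 1 / (of_int (c 1) + 1)"
    using l1 by (intro LIMSEQ_le_const) auto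
  moreover have "1 / (of_int (c 1) + 1) > (0::real)"
    using pos[of 1] by simp
  ultimately have xpos: "x - of_int (c 0) > 0" by linarith
  define y where "y = 1 / (x - of_int (c 0))"
  have lt: "?t \<longlonglongrightarrow> y"
    using tendsto_divide[OF tendsto_const[of 1] l1] xpos by (simp add: y_def)
  have "y \<ge> 1"
    using lt t1 by (intro LIMSEQ_le_const) auto
  moreover have "x = of_int (c 0) + 1 / y"
    by (simp add: y_def)
  moreover have "has_regular_cf y (\<lambda>i. c (Suc i))"
    using pos lt by (simp add: has_regular_cf_def)
  ultimately show ?thesis using that by blast
qed

text \<open>One tail only gives \<open>y \<ge> 1\<close>. Splitting off a second one makes this
  strict, so that \<open>1 / y < 1\<close>.\<close>

lemma has_regular_cf_floor:
  assumes "has_regular_cf x c"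
  shows "c 0 = \<lfloor>x\<rfloor>"
proof -
  obtain y where y: "x = of_int (c 0) + 1 / y" "has_regular_cf y (\<lambda>i. c (Suc i))"
    using has_regular_cf_tail[OF assms] by blast
  obtain z where z: "z \<ge> 1" "y = of_int (c (Suc 0)) + 1 / z"
    using has_regular_cf_tail[OF y(2)] by blast
  have "real_of_int (c (Suc 0)) \<ge> 1"
    using assms unfolding has_regular_cf_def by (metis One_nat_def le_refl of_int_1_le_iff int_one_le_iff_zero_less)
  moreover have "1 / z > 0" using z(1) by simp
  ultimately have "y > 1" using z(2) by linarith
  then have "0 < 1 / y" "1 / y < 1" by simp_all
  then show ?thesis using y(1) by linarith
qed

text \<open>The value fixes \<open>c 0\<close> as its floor and thereby also the value of the tail;
  induction on the index does the rest.\<close>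

lemma has_regular_cf_unique:
  assumes "has_regular_cf x c" "has_regular_cf x c'"
  shows "c = c'"
proof
  fix n
  show "c n = c' n"
    using assms
  proof (induction n arbitrary: x c c')
    case 0
    then show ?case by (simp add: has_regular_cf_floor)
  next
    case (Suc n)
    obtain y where y: "y \<ge> 1" "x = of_int (c 0) + 1 / y" "has_regular_cf y (\<lambda>i. c (Suc i))"
      using has_regular_cf_tail[OF Suc.prems(1)] by blast
    obtain y' where y': "y' \<ge> 1" "x = of_int (c' 0) + 1 / y'" "has_regular_cf y' (\<lambda>i. c' (Suc i))"
      using has_regular_cf_tail[OF Suc.prems(2)] by blast
    have "c 0 = c' 0"
      using Suc.prems by (simp add: has_regular_cf_floor)
    then have "y = y'" using y y' by simp
    then show ?case using Suc.IH[OF y(3)] y'(3) by simp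
  qed
qed

text \<open>Two consecutive steps contract the error by a factor \<open>x 1 * x 2 = c 1 * x 2 + 1 \<ge> 2\<close>.\<close>

lemma cf_convergent_error:
  fixes x :: "nat \<Rightarrow> real"
  assumes "\<And>n. n \<ge> 1 \<Longrightarrow> c n > 0" "\<And>n. x (Suc n) > 0" "\<And>n. x n = of_int (c n) + 1 / x (Suc n)"
  shows "\<bar>cf_convergent c (2 * n) - x 0\<bar> \<le> (1/2) ^ n \<and>
    \<bar>cf_convergent c (Suc (2 * n)) - x 0\<bar> \<le> (1/2) ^ n"
  using assms
proof (induction n arbitrary: c x)
  case 0
  have "real_of_int (c 1) \<ge> 1" using 0(1)[of 1] by simp
  moreover have "1 / x 2 > 0" using 0(2)[of 1] by (simp add: numeral_2_eq_2)
  ultimately have "x 1 > 1" using 0(3)[of 1] by (simp only: numeral_2_eq_2 One_nat_def)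
  then have "0 < 1 / x 1" "1 / x 1 < 1" by simp_all
  moreover have "0 < 1 / real_of_int (c 1)" "1 / real_of_int (c 1) \<le> 1"
    using \<open>real_of_int (c 1) \<ge> 1\<close> by simp_all
  ultimately have "\<bar>1 / real_of_int (c 1) - 1 / x 1\<bar> \<le> 1" by linarith
  moreover have "x 0 = of_int (c 0) + 1 / x 1" using 0(3)[of 0] by simp
  ultimately show ?case using \<open>0 < 1 / x 1\<close> \<open>1 / x 1 < 1\<close> by simp
next
  case (Suc n)
  let ?t = "cf_convergent (\<lambda>i. c (Suc i))" and ?u = "cf_convergent (\<lambda>i. c (Suc (Suc i)))"
  have c1: "real_of_int (c (Suc 0)) \<ge> 1" using Suc.prems(1)[of 1] by simp
  have x1: "x (Suc 0) > 0" and x2: "x (Suc (Suc 0)) > 0" by (rule Suc.prems(2))+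
  have gt1: "x (Suc (Suc 0)) > 1"
  proof -
    have "real_of_int (c (Suc (Suc 0))) \<ge> 1" using Suc.prems(1)[of "Suc (Suc 0)"] by simp
    moreover have "1 / x (Suc (Suc (Suc 0))) > 0" using Suc.prems(2) by simp
    ultimately show ?thesis using Suc.prems(3)[of "Suc (Suc 0)"] by linarith
  qed
  have step: "\<bar>cf_convergent c (Suc (Suc N)) - x 0\<bar> \<le> \<bar>?u N - x (Suc (Suc 0))\<bar> / 2" for N
  proof -
    have u1: "?u N \<ge> 1"
      using cf_convergent_tail_ge_1[of "\<lambda>i. c (Suc i)"] Suc.prems(1) by simp
    define u where "u = ?u N"
    define y where "y = x (Suc (Suc 0))"
    define p where "p = real_of_int (c (Suc 0))"
    have upos: "u \<ge> 1" "y > 1" "p \<ge> 1" using u1 gt1 c1 by (simp_all add: u_def y_def p_def)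
    have "cf_convergent c (Suc (Suc N)) - x 0 = 1 / (p + 1 / u) - 1 / (p + 1 / y)"
      using Suc.prems(3)[of 0] Suc.prems(3)[of "Suc 0"] by (simp add: u_def y_def p_def)
    also have "\<dots> = u / (p * u + 1) - y / (p * y + 1)"
      using upos by (simp add: field_simps)
    also have "\<dots> = (u - y) / ((p * u + 1) * (p * y + 1))"
    proof -
      have "p * u + 1 > 0" "p * y + 1 > 0" using upos by (auto intro!: add_pos_pos mult_pos_pos)
      then show ?thesis by (simp add: divide_simps) (simp add: algebra_simps)
    qed
    finally have eq: "\<bar>cf_convergent c (Suc (Suc N)) - x 0\<bar> = \<bar>u - y\<bar> / \<bar>(p * u + 1) * (p * y + 1)\<bar>"
      by (simp add: abs_divide)
    \<comment> \<open>Each factor of the denominator is at least 2; halving the error is all that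
      the induction asks for.\<close>
    have "p * u \<ge> 1 * 1" "p * y \<ge> 1 * 1" using upos by (intro mult_mono; simp)+
    then have "(p * u + 1) * (p * y + 1) \<ge> 2 * 1" by (intro mult_mono) auto
    then have "\<bar>u - y\<bar> / \<bar>(p * u + 1) * (p * y + 1)\<bar> \<le> \<bar>u - y\<bar> / 2"
      by (intro divide_left_mono) auto
    then show ?thesis using eq by (simp add: u_def y_def)
  qed
  have IH: "\<bar>?u (2 * n) - x (Suc (Suc 0))\<bar> \<le> (1/2) ^ n \<and>
    \<bar>?u (Suc (2 * n)) - x (Suc (Suc 0))\<bar> \<le> (1/2) ^ n"
  proof (rule Suc.IH[of "\<lambda>i. c (Suc (Suc i))" "\<lambda>i. x (Suc (Suc i))"])
    show "c (Suc (Suc n)) > 0" if "n \<ge> 1" for n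
      using Suc.prems(1) by simp
  qed (rule Suc.prems)+
  show ?case
    using step[of "2 * n"] step[of "Suc (2 * n)"] IH by simp
qed

text \<open>Certifies an expansion by exhibiting complete quotients: the two-step contraction bounds
  the error of the \<open>n\<close>-th convergent by \<open>(1/2) ^ (n div 2)\<close>.\<close>

lemma has_regular_cfI:
  fixes x :: "nat \<Rightarrow> real"
  assumes "\<And>n. n \<ge> 1 \<Longrightarrow> c n > 0" "\<And>n. x (Suc n) > 0" "\<And>n. x n = of_int (c n) + 1 / x (Suc n)"
  shows "has_regular_cf (x 0) c"
proof -
  have err: "\<bar>cf_convergent c (2 * n) - x 0\<bar> \<le> (1/2) ^ n \<and>
      \<bar>cf_convergent c (Suc (2 * n)) - x 0\<bar> \<le> (1/2) ^ n" for n
    by (rule cf_convergent_error) (rule assms, assumption | rule assms)+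
  have bound: "\<bar>cf_convergent c n - x 0\<bar> \<le> (1/2) ^ (n div 2)" for n
  proof (cases "even n")
    case True
    then show ?thesis using err[of "n div 2"] by simp
  next
    case False
    then have "n = Suc (2 * (n div 2))" by simp
    then show ?thesis using err[of "n div 2"] by metis
  qed
  have "(\<lambda>n. (1/2::real) ^ (n div 2)) \<longlonglongrightarrow> 0"
  proof -
    have "filterlim (\<lambda>n::nat. n div 2) at_top at_top"
      unfolding filterlim_at_top
    proof
      fix Z :: nat
      show "\<forall>\<^sub>F n in sequentially. Z \<le> n div 2"
        using eventually_ge_at_top[of "2 * Z"] by eventually_elim linarith
    qed
    moreover have "(\<lambda>n. (1/2::real) ^ n) \<longlonglongrightarrow> 0"
      by (rule LIMSEQ_realpow_zero) simp_all
    ultimately show ?thesis by (rule filterlim_compose[rotated])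
  qed
  then have "(\<lambda>n. cf_convergent c n - x 0) \<longlonglongrightarrow> 0"
    by (rule tendsto_0_le[where K = 1]) (simp add: bound)
  then show ?thesis
    using assms(1) by (simp add: has_regular_cf_def LIM_zero_iff)
qed

section \<open>Periodic continued fractions\<close>

text \<open>\<open>cf_chain x cs y\<close> says that \<open>x = [c\<^sub>1; \<dots>, c\<^sub>n, y]\<close> with positive complete quotients.\<close>

primrec cf_chain :: "real \<Rightarrow> int list \<Rightarrow> real \<Rightarrow> bool" where
  "cf_chain x [] y \<longleftrightarrow> x = y"
| "cf_chain x (c # cs) y \<longleftrightarrow> (\<exists>z>0. x = of_int c + 1 / z \<and> cf_chain z cs y)"

lemma cf_chain_append:
  "cf_chain x cs y \<Longrightarrow> cf_chain y ds z \<Longrightarrow> cf_chain x (cs @ ds) z"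
  by (induction cs arbitrary: x) auto

text \<open>A chain from \<open>y\<close> back to \<open>y\<close> can be unrolled forever. The
  invariant is that the \<open>n\<close>-th complete quotient reaches \<open>y\<close> along the
  part of the block not yet consumed.\<close>

lemma has_regular_cf_periodic:
  assumes loop: "cf_chain y bs y" and "y > 0" "bs \<noteq> []" and pos: "\<forall>b\<in>set bs. b > 0"
  shows "has_regular_cf (of_int a0 + 1 / y) (periodic_cf a0 bs)"
proof -
  define L where "L = length bs"
  have L: "L > 0" using assms(3) by (simp add: L_def)
  define z where "z = rec_nat y (\<lambda>n u. 1 / (u - of_int (bs ! (n mod L))))"
  have z0: "z 0 = y" and zS: "\<And>n. z (Suc n) = 1 / (z n - of_int (bs ! (n mod L)))"
    by (simp_all add: z_def)
  have step: "z n = of_int (bs ! (n mod L)) + 1 / z (Suc n) \<and> z (Suc n) > 0 \<and>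
      cf_chain (z (Suc n)) (drop (Suc n mod L) bs) y"
    if chain: "cf_chain (z n) (drop (n mod L) bs) y" for n
  proof -
    have "n mod L < L" using L by simp
    then have "drop (n mod L) bs = bs ! (n mod L) # drop (Suc (n mod L)) bs"
      by (simp add: Cons_nth_drop_Suc L_def)
    then obtain w where w: "w > 0" "z n = of_int (bs ! (n mod L)) + 1 / w"
        "cf_chain w (drop (Suc (n mod L)) bs) y"
      using chain by auto
    have zw: "z (Suc n) = w" using w(2) by (simp add: zS)
    \<comment> \<open>At the end of the block the chain has arrived at \<open>y\<close>, and
      \<open>loop\<close> starts the next round.\<close>
    have "cf_chain w (drop (Suc n mod L) bs) y"
    proof (cases "Suc (n mod L) = L")
      case True
      then have "w = y" using w(3) by (simp add: L_def)
      moreover have "Suc n mod L = 0" using True by (simp add: mod_Suc)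
      ultimately show ?thesis using loop by simp
    next
      case False
      then have "Suc n mod L = Suc (n mod L)" by (simp add: mod_Suc)
      then show ?thesis using w(3) by simp
    qed
    then show ?thesis using w zw by simp
  qed
  have chain: "cf_chain (z n) (drop (n mod L) bs) y" for n
  proof (induction n)
    case 0
    then show ?case using loop by (simp add: z0)
  next
    case (Suc n)
    then show ?case using step by blast
  qed
  define x where "x n = (case n of 0 \<Rightarrow> of_int a0 + 1 / y | Suc n' \<Rightarrow> z n')" for n
  have zpos: "z n > 0" for n
  proof (cases n)
    case 0
    then show ?thesis using z0 assms(2) by simp
  next
    case (Suc n')
    then show ?thesis using step[OF chain] by blast
  qed
  have "has_regular_cf (x 0) (periodic_cf a0 bs)"
  proof (rule has_regular_cfI)
    show "periodic_cf a0 bs n > 0" if "n \<ge> 1" for n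
      using that pos L by (simp add: periodic_cf_def L_def)
    show "x (Suc n) > 0" for n using zpos by (simp add: x_def)
    show "x n = of_int (periodic_cf a0 bs n) + 1 / x (Suc n)" for n
    proof (cases n)
      case 0
      then show ?thesis by (simp add: x_def periodic_cf_def z0)
    next
      case (Suc n')
      then show ?thesis using step[OF chain, of n'] by (simp add: x_def periodic_cf_def L_def)
    qed
  qed
  then show ?thesis by (simp add: x_def)
qed

text \<open>Since \<open>b\<close> marks only the end of the block, its positions in the expansion
  are exactly the positive multiples of the block length. Any eventual period must map such
  positions to such positions, so it is itself a multiple.\<close>

lemma cf_period_length_eq:
  assumes cf: "has_regular_cf (sqrt (of_int D)) (periodic_cf a0 (bs @ [b]))" and "b \<notin> set bs"
  shows "cf_period_length D = Suc (length bs)"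
  unfolding cf_period_length_def
proof (rule Least_equality)
  let ?L = "Suc (length bs)" and ?c = "periodic_cf a0 (bs @ [b])"
  have "?c (n + ?L) = ?c n" if "n \<ge> 1" for n
  proof -
    have "n + ?L - 1 = (n - 1) + ?L" using that by simp
    then have "(n + ?L - 1) mod ?L = (n - 1) mod ?L" by (metis mod_add_self2)
    then show ?thesis using that by (simp add: periodic_cf_def)
  qed
  then show "?L > 0 \<and> (\<exists>c. has_regular_cf (sqrt (of_int D)) c \<and> (\<exists>N. \<forall>n\<ge>N. c (n + ?L) = c n))"
    using cf by blast
next
  fix p
  let ?L = "Suc (length bs)" and ?c = "periodic_cf a0 (bs @ [b])"
  assume "p > 0 \<and> (\<exists>c. has_regular_cf (sqrt (of_int D)) c \<and> (\<exists>N. \<forall>n\<ge>N. c (n + p) = c n))"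
  \<comment> \<open>Uniqueness identifies the arbitrary expansion with \<open>?c\<close>.\<close>
  then obtain N where p: "p > 0" and N: "\<And>n. n \<ge> N \<Longrightarrow> ?c (n + p) = ?c n"
    using has_regular_cf_unique[OF cf] by blast
  have last_iff: "?c n = b \<longleftrightarrow> ?L dvd n" if "n \<ge> 1" for n
  proof -
    obtain q where n: "n = Suc q" using \<open>n \<ge> 1\<close> by (cases n) auto
    have "?c n = b \<longleftrightarrow> q mod ?L = length bs"
    proof -
      have "q mod ?L < ?L" by simp
      moreover have "bs ! i \<noteq> b" if "i < length bs" for i
        using that assms(2) nth_mem by blast
      ultimately show ?thesis by (auto simp: n periodic_cf_def nth_append less_Suc_eq)
    qed
    also have "\<dots> \<longleftrightarrow> ?L dvd n"
      by (auto simp: n dvd_eq_mod_eq_0 mod_Suc)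
    finally show ?thesis .
  qed
  \<comment> \<open>A positive multiple of the block length beyond the preperiod bound
    \<open>N\<close>.\<close>
  define n where "n = Suc N * ?L"
  have n: "n \<ge> 1" "n \<ge> N"
    by (simp_all add: n_def)
  have Ln: "?L dvd n"
    unfolding n_def by (rule dvd_triv_right)
  have "?c n = b" using last_iff n(1) Ln by blast
  then have "?c (n + p) = b" using N n by simp
  then have "?L dvd n + p" using last_iff n by simp
  then have "?L dvd p" using Ln by (metis dvd_add_right_iff)
  then show "?L \<le> p" using p by (rule dvd_imp_le)
qed

section \<open>Complete quotients\<close>

definition surd :: "real \<Rightarrow> int \<Rightarrow> int \<Rightarrow> real" where
  "surd d P Q = (of_int P + d) / of_int Q"

text \<open>The classical recurrence for complete quotients, obtained by rationalising
  \<open>d - P'\<close>. The integer \<open>B\<close> is a lower bound for \<open>d\<close> that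
  reduces \<open>P' + d > 0\<close> to an integer inequality.\<close>

lemma surd_step:
  assumes "d\<^sup>2 = of_int D" "Q > 0" "P' = c * Q - P" "Q * Q' = D - P'\<^sup>2"
    "of_int B < d" "P' + B \<ge> 0"
  shows "surd d P Q = of_int c + 1 / surd d P' Q'"
proof -
  have "of_int (P' + B) \<ge> (0::real)" using assms(6) by (simp only: of_int_0_le_iff)
  then have pos: "of_int P' + d > 0" using assms(5) by simp
  have "real_of_int (Q * Q') = of_int (D - P'\<^sup>2)" using assms(4) by simp
  then have QQ: "real_of_int Q * of_int Q' = (d - of_int P') * (d + of_int P')"
    using assms(1) by (simp add: power2_eq_square algebra_simps)
  have "real_of_int Q > 0" using assms(2) by simp
  then have "of_int Q' / (of_int P' + d) = (d - of_int P') / real_of_int Q"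
    using QQ pos by (simp add: field_simps)
  also have "\<dots> = surd d P Q - of_int c"
    using \<open>real_of_int Q > 0\<close> by (simp add: assms(3) surd_def field_simps)
  finally show ?thesis by (simp add: surd_def)
qed

lemma surd_pos:
  assumes "of_int B < d" "P + B \<ge> 0" "Q > 0"
  shows "surd d P Q > 0"
proof -
  have "of_int (P + B) \<ge> (0::real)" using assms(2) by (simp only: of_int_0_le_iff)
  then show ?thesis using assms by (simp add: surd_def)
qed

lemma cf_chain_surd_Cons:
  assumes "d\<^sup>2 = of_int D" "of_int B < d" "Q > 0"
    and "P' = c * Q - P" "Q * Q' = D - P'\<^sup>2" "P' + B \<ge> 0" "Q' > 0"
    and "cf_chain (surd d P' Q') cs y"
  shows "cf_chain (surd d P Q) (c # cs) y"
  using surd_step[OF assms(1,3-5,2,6)] surd_pos[OF assms(2,6,7)] assms(8) by auto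

section \<open>The surds attached to \<open>D\<close>, with \<open>R\<close> in the role of
  \<open>r ^ k\<close>\<close>

locale surd_family =
  fixes a m s R A D :: int and d :: real
  assumes a: "a > 1" and m: "m > 0" and s: "s > 0" and R: "R > 0"
    and A: "A = s + a * R" and D: "D = m * (m * A\<^sup>2 - 2 * R)"
    and d: "d\<^sup>2 = of_int D" and d_gt: "of_int (m * A - 1) < d"
begin

text \<open>For \<open>R = \<rho> * \<sigma>\<close> the denominators of \<open>fwd\<close> and
  \<open>bwd\<close> multiply to \<open>D - (m * A - \<rho>)\<^sup>2\<close>: they are the two
  neighbours \<open>Q\<close>, \<open>Q'\<close> of the same numerator, one for each direction of
  travel.\<close>

abbreviation (input) fwd :: "int \<Rightarrow> int \<Rightarrow> real" where
  "fwd \<rho> \<sigma> \<equiv> surd d (m * A - \<rho>) (2 * m * A - \<rho> - 2 * m * \<sigma>)"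

abbreviation (input) bwd :: "int \<Rightarrow> real" where
  "bwd \<rho> \<equiv> surd d (m * A - \<rho>) \<rho>"

text \<open>Both factors of \<open>R\<close> are at most \<open>R\<close>, while
  \<open>A > a * R \<ge> 2 * R\<close>. This supplies the sign conditions of the steps, with
  \<open>B = m * A - 1\<close>.\<close>

lemma bounds:
  assumes "\<rho> > 0" "\<sigma> > 0" "R = \<rho> * \<sigma>"
  shows "m * A > 2 * m * \<sigma>" "m * A > 2 * \<rho>" "2 * m * A - \<rho> - 2 * m * \<sigma> > 0" "m * A > 0"
    "m * A - \<rho> + (m * A - 1) \<ge> 0" "m * A - 2 * m * \<sigma> + (m * A - 1) \<ge> 0"
proof -
  have "R \<ge> \<sigma> * 1" "R \<ge> \<rho> * 1"
    using assms by (simp_all add: mult.commute[of \<rho>] del: mult_1_right)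
  moreover have "a * R \<ge> 2 * R" using a R by simp
  ultimately have "A > 2 * \<sigma>" "A > 2 * \<rho>" using A s by linarith+
  then show 1: "m * A > 2 * m * \<sigma>" using m by simp
  have "m * A > m * (2 * \<rho>)" using \<open>A > 2 * \<rho>\<close> m by simp
  moreover have "m * (2 * \<rho>) \<ge> 1 * (2 * \<rho>)" using m assms(1) by (intro mult_right_mono) auto
  ultimately show 2: "m * A > 2 * \<rho>" by linarith
  then show "m * A > 0" "m * A - \<rho> + (m * A - 1) \<ge> 0" using assms(1) by linarith+
  then show "m * A - 2 * m * \<sigma> + (m * A - 1) \<ge> 0" using 1 by linarith
  show "2 * m * A - \<rho> - 2 * m * \<sigma> > 0" using 1 2 assms(1) by linarith
qed

text \<open>The locale does not compare \<open>s\<close> with \<open>R\<close>, so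
  \<open>a * R - s\<close> may have either sign; adding \<open>m * A\<close> cancels
  \<open>s\<close>.\<close>

lemma mid_bound: "m * (a * R - s) + (m * A - 1) \<ge> 0"
proof -
  have "m * (a * R - s) + (m * A - 1) = 2 * (m * (a * R)) - 1"
    by (simp add: A algebra_simps)
  moreover have "m * (a * R) > 0" using m a R by simp
  ultimately show ?thesis by linarith
qed

text \<open>Three partial quotients move one factor \<open>r\<close> from the second argument of
  \<open>fwd\<close> to the first.\<close>

lemma fwd_block:
  assumes "\<rho> > 0" "\<sigma> > 0" "r > 0" "r = 2 * a * m * s - 1" "R = \<rho> * (r * \<sigma>)"
  shows "cf_chain (fwd \<rho> (r * \<sigma>)) [1, a * \<rho> - 1, 2 * a * m * \<sigma> - 1] (fwd (r * \<rho>) \<sigma>)"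
proof -
  note b1 = bounds[of \<rho> "r * \<sigma>"] and b2 = bounds[of "r * \<rho>" \<sigma>]
  have pos: "r * \<sigma> > 0" "r * \<rho> > 0" "R = r * \<rho> * \<sigma>" using assms by simp_all
  note step = cf_chain_surd_Cons[OF d d_gt]
  show ?thesis
  proof (rule step[where P' = "m * A - 2 * m * (r * \<sigma>)" and Q' = "2 * m * (r * \<sigma>)"])
    show "(2 * m * A - \<rho> - 2 * m * (r * \<sigma>)) * (2 * m * (r * \<sigma>)) = D - (m * A - 2 * m * (r * \<sigma>))\<^sup>2"
      unfolding D assms(5) by (simp add: power2_eq_square algebra_simps)
    show "cf_chain (surd d (m * A - 2 * m * (r * \<sigma>)) (2 * m * (r * \<sigma>)))
        [a * \<rho> - 1, 2 * a * m * \<sigma> - 1] (fwd (r * \<rho>) \<sigma>)"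
    proof (rule step[where P' = "m * (a * R - s)" and Q' = "r * \<rho>"])
      show "m * (a * R - s) = (a * \<rho> - 1) * (2 * m * (r * \<sigma>)) - (m * A - 2 * m * (r * \<sigma>))"
        unfolding A assms(5) by (simp add: algebra_simps)
      \<comment> \<open>Here the choice of \<open>r\<close> enters: as
        \<open>A\<^sup>2 - (a * R - s)\<^sup>2 = 4 * a * s * R\<close>, the last factor is exactly
        \<open>r\<close>.\<close>
      have "D - (m * (a * R - s))\<^sup>2 = 2 * m * R * (2 * a * m * s - 1)"
        unfolding D A by (simp add: power2_eq_square algebra_simps)
      then show "2 * m * (r * \<sigma>) * (r * \<rho>) = D - (m * (a * R - s))\<^sup>2"
        unfolding assms(4)[symmetric] by (simp add: assms(5))
      show "cf_chain (surd d (m * (a * R - s)) (r * \<rho>)) [2 * a * m * \<sigma> - 1] (fwd (r * \<rho>) \<sigma>)"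
      proof (rule step[where P' = "m * A - r * \<rho>" and Q' = "2 * m * A - r * \<rho> - 2 * m * \<sigma>"])
        show "m * A - r * \<rho> = (2 * a * m * \<sigma> - 1) * (r * \<rho>) - m * (a * R - s)"
          unfolding A assms(5) by (simp add: algebra_simps)
        show "r * \<rho> * (2 * m * A - r * \<rho> - 2 * m * \<sigma>) = D - (m * A - r * \<rho>)\<^sup>2"
          unfolding D assms(5) by (simp add: power2_eq_square algebra_simps)
      qed (use pos b2 assms in auto)
    qed (use pos m mid_bound in auto)
  qed (use pos b1 assms m in auto)
qed

text \<open>The forward block read backwards: \<open>P + P' = c * Q\<close> is symmetric in
  \<open>P\<close>, \<open>P'\<close>, and \<open>Q * Q' = D - P'\<^sup>2\<close> is symmetric in
  \<open>Q\<close>, \<open>Q'\<close>.\<close>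

lemma bwd_block:
  assumes "\<rho> > 0" "\<sigma> > 0" "r > 0" "r = 2 * a * m * s - 1" "R = \<rho> * (r * \<sigma>)"
  shows "cf_chain (bwd (r * \<rho>)) [2 * a * m * \<sigma> - 1, a * \<rho> - 1, 1] (bwd \<rho>)"
proof -
  note b1 = bounds[of \<rho> "r * \<sigma>"]
  have pos: "r * \<sigma> > 0" "r * \<rho> > 0" using assms by simp_all
  note step = cf_chain_surd_Cons[OF d d_gt]
  show ?thesis
  proof (rule step[where P' = "m * (a * R - s)" and Q' = "2 * m * (r * \<sigma>)"])
    show "m * (a * R - s) = (2 * a * m * \<sigma> - 1) * (r * \<rho>) - (m * A - r * \<rho>)"
      unfolding A assms(5) by (simp add: algebra_simps)
    have "D - (m * (a * R - s))\<^sup>2 = 2 * m * R * (2 * a * m * s - 1)"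
      unfolding D A by (simp add: power2_eq_square algebra_simps)
    then show "r * \<rho> * (2 * m * (r * \<sigma>)) = D - (m * (a * R - s))\<^sup>2"
      unfolding assms(4)[symmetric] by (simp add: assms(5))
    show "cf_chain (surd d (m * (a * R - s)) (2 * m * (r * \<sigma>))) [a * \<rho> - 1, 1] (bwd \<rho>)"
    proof (rule step[where P' = "m * A - 2 * m * (r * \<sigma>)" and Q' = "2 * m * A - \<rho> - 2 * m * (r * \<sigma>)"])
      show "m * A - 2 * m * (r * \<sigma>) = (a * \<rho> - 1) * (2 * m * (r * \<sigma>)) - m * (a * R - s)"
        unfolding A assms(5) by (simp add: algebra_simps)
      show "2 * m * (r * \<sigma>) * (2 * m * A - \<rho> - 2 * m * (r * \<sigma>)) = D - (m * A - 2 * m * (r * \<sigma>))\<^sup>2"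
        unfolding D assms(5) by (simp add: power2_eq_square algebra_simps)
      show "cf_chain (surd d (m * A - 2 * m * (r * \<sigma>)) (2 * m * A - \<rho> - 2 * m * (r * \<sigma>))) [1] (bwd \<rho>)"
      proof (rule step[where P' = "m * A - \<rho>" and Q' = \<rho>])
        show "(2 * m * A - \<rho> - 2 * m * (r * \<sigma>)) * \<rho> = D - (m * A - \<rho>)\<^sup>2"
          unfolding D assms(5) by (simp add: power2_eq_square algebra_simps)
      qed (use pos b1 assms in auto)
    qed (use pos b1 assms m in auto)
  qed (use pos m mid_bound in auto)
qed

text \<open>The turning point, reached once all factors \<open>r\<close> have moved.\<close>

lemma mid_block: "cf_chain (fwd R 1) [1, A - 2, 1] (bwd R)"
proof -
  have b: "m * A > 2 * m" "m * A > 2 * R" "2 * m * A - R - 2 * m > 0" "m * A > 0"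
    "m * A - R + (m * A - 1) \<ge> 0" "m * A - 2 * m + (m * A - 1) \<ge> 0"
    using bounds[of R 1] R by simp_all
  note step = cf_chain_surd_Cons[OF d d_gt]
  show ?thesis
  proof (rule step[where P' = "m * A - 2 * m" and Q' = "2 * m"])
    show "(2 * m * A - R - 2 * m * 1) * (2 * m) = D - (m * A - 2 * m)\<^sup>2"
      unfolding D by (simp add: power2_eq_square algebra_simps)
    show "cf_chain (surd d (m * A - 2 * m) (2 * m)) [A - 2, 1] (bwd R)"
    \<comment> \<open>The centre of symmetry: \<open>P' = P\<close>, so \<open>2 * P = c * Q\<close>
      with \<open>Q = 2 * m\<close> forces \<open>c = A - 2\<close>.\<close>
    proof (rule step[where P' = "m * A - 2 * m" and Q' = "2 * m * A - R - 2 * m"])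
      show "2 * m * (2 * m * A - R - 2 * m) = D - (m * A - 2 * m)\<^sup>2"
        unfolding D by (simp add: power2_eq_square algebra_simps)
      show "cf_chain (surd d (m * A - 2 * m) (2 * m * A - R - 2 * m)) [1] (bwd R)"
      proof (rule step[where P' = "m * A - R" and Q' = R])
        show "(2 * m * A - R - 2 * m) * R = D - (m * A - R)\<^sup>2"
          unfolding D by (simp add: power2_eq_square algebra_simps)
      qed (use b R in auto)
    qed (use b R m in \<open>auto simp: algebra_simps\<close>)
  qed (use b R m in auto)
qed

text \<open>The second centre of symmetry: again \<open>P' = P\<close>, now with
  \<open>Q = 1\<close>, so the partial quotient is \<open>2 * P\<close>. This closes the
  loop.\<close>

lemma end_block: "cf_chain (bwd 1) [2 * m * A - 2] (fwd 1 R)"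
proof -
  have b: "m * A - 1 + (m * A - 1) \<ge> 0" "2 * m * A - 1 - 2 * m * R > 0" "m * A > 0"
    using bounds[of 1 R] R by simp_all
  show ?thesis
  proof (rule cf_chain_surd_Cons[OF d d_gt, where P' = "m * A - 1"
        and Q' = "2 * m * A - 1 - 2 * m * R"])
    show "1 * (2 * m * A - 1 - 2 * m * R) = D - (m * A - 1)\<^sup>2"
      unfolding D by (simp add: power2_eq_square algebra_simps)
  qed (use b in auto)
qed

text \<open>Splitting the integer part off \<open>d = surd d 0 1\<close> enters the loop at
  \<open>fwd 1 R\<close>.\<close>

lemma fwd_start: "fwd 1 R > 0" "d = of_int (m * A - 1) + 1 / fwd 1 R"
proof -
  have b: "m * A - 1 + (m * A - 1) \<ge> 0" "2 * m * A - 1 - 2 * m * R > 0" "m * A > 0"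
    using bounds[of 1 R] R by simp_all
  show "fwd 1 R > 0"
    by (rule surd_pos[OF d_gt b(1,2)])
  have "surd d 0 1 = of_int (m * A - 1) + 1 / fwd 1 R"
  proof (rule surd_step[OF d _ _ _ d_gt])
    show "1 * (2 * m * A - 1 - 2 * m * R) = D - (m * A - 1)\<^sup>2"
      unfolding D by (simp add: power2_eq_square algebra_simps)
  qed (use b in auto)
  then show "d = of_int (m * A - 1) + 1 / fwd 1 R" by (simp add: surd_def)
qed

end

section \<open>Assembling the blocks into the full period of \<open>sqrt D\<close>\<close>

theorem theorem4:
  fixes a m s r D :: int and k :: nat and b :: "nat \<Rightarrow> int"
  assumes "a > 1" and "m > 0" and "s > 0" and "k > 0"
    and "r = 2 * a * m * s - 1"
    and "D = m * (m * (s + a * r ^ k)\<^sup>2 - 2 * r ^ k)"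
    and "\<And>j. j < k \<Longrightarrow> b (3 * j + 1) = 1"
    and "\<And>j. j < k \<Longrightarrow> b (3 * j + 2) = a * r ^ j - 1"
    and "\<And>j. j < k \<Longrightarrow> b (3 * j + 3) = 2 * a * m * r ^ (k - 1 - j) - 1"
  shows "cf_period_length D = 6 * k + 4 \<and>
    has_regular_cf (sqrt (of_int D))
      (periodic_cf (m * (s + a * r ^ k) - 1)
        (map b [1..<3 * k + 1] @ [1, s + a * r ^ k - 2, 1] @ rev (map b [1..<3 * k + 1])
          @ [2 * m * (s + a * r ^ k) - 2]))"
proof -
  define R where "R = r ^ k"
  define A where "A = s + a * R"
  define d where "d = sqrt (of_int D)"
  have ms: "m * s \<ge> 1" "a * m \<ge> 2"
    using assms(1-3) mult_mono[of 1 m 1 s] mult_mono[of 2 a 1 m] by simp_all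
  then have "a * (m * s) \<ge> 2 * 1" using assms(1) by (intro mult_mono) auto
  then have r: "r \<ge> 3" using assms(5) by (simp add: mult.assoc)
  then have rpow: "r ^ i \<ge> 1" for i by simp
  have R: "R \<ge> 1" using rpow by (simp add: R_def)
  have aR: "a * R \<ge> 2 * R" using assms(1) R by simp
  have D: "D = m * (m * A\<^sup>2 - 2 * R)" using assms(6) by (simp add: A_def R_def)
  have AR: "A > 2 * R" using aR assms(3) by (simp add: A_def)
  have mAR: "m * A > m * (2 * R)" using AR assms(2) by simp
  have mR: "m * R \<ge> 1" using mult_mono[of 1 m 1 R] assms(2) R by simp
  \<comment> \<open>Positivity of this difference gives \<open>m * A - 1 < d\<close>, the estimate
    of \<open>d\<close> that the locale asks for.\<close>
  have "D - (m * A - 1)\<^sup>2 = 2 * (m * A) - 2 * (m * R) - 1"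
    unfolding D by (simp add: power2_eq_square algebra_simps)
  then have "(m * A - 1)\<^sup>2 < D" using mAR mR by simp
  then have "of_int ((m * A - 1)\<^sup>2) < real_of_int D" by (simp only: of_int_less_iff)
  then have d_gt: "of_int (m * A - 1) < d"
    unfolding d_def by (intro real_less_rsqrt) simp
  have "D \<ge> 0" using \<open>(m * A - 1)\<^sup>2 < D\<close> by (meson less_le_trans not_less zero_le_power2 less_imp_le)
  then have d: "d\<^sup>2 = of_int D" by (simp add: d_def)
  have "R > 0" using R by simp
  interpret surd_family a m s R A D d
    by (rule surd_family.intro) fact+
  let ?bs = "\<lambda>j. map b [1..<3 * j + 1]"
  have bs_Suc: "?bs (Suc j) = ?bs j @ [1, a * r ^ j - 1, 2 * a * m * r ^ (k - 1 - j) - 1]"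
    if "j < k" for j
  proof -
    have "[1..<3 * Suc j + 1] = [1..<3 * j + 1] @ [3 * j + 1, 3 * j + 2, 3 * j + 3]"
      by (simp add: upt_rec[of _ "Suc (Suc (Suc (3 * j + 1)))"] numeral_3_eq_3)
    then show ?thesis
      using assms(7-9)[OF that] by simp
  qed
  \<comment> \<open>Exhibits the factor \<open>r\<close> that the block lemmas move, with
    \<open>\<rho> = r ^ j\<close> and \<open>\<sigma> = r ^ (k - 1 - j)\<close>.\<close>
  have R_split: "R = r ^ j * (r * r ^ (k - 1 - j))" "r ^ (k - j) = r * r ^ (k - 1 - j)"
    if "j < k" for j
  proof -
    have "k - j = Suc (k - 1 - j)" "k = j + (k - j)" using that by simp_all
    then show "r ^ (k - j) = r * r ^ (k - 1 - j)" by simp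
    then show "R = r ^ j * (r * r ^ (k - 1 - j))"
      using \<open>k = j + (k - j)\<close> by (metis R_def power_add)
  qed
  have fwd_chain: "cf_chain (fwd 1 R) (?bs j) (fwd (r ^ j) (r ^ (k - j)))" if "j \<le> k" for j
    using that
  proof (induction j)
    case 0
    then show ?case by (simp add: R_def)
  next
    case (Suc j)
    have "cf_chain (fwd (r ^ j) (r ^ (k - j))) [1, a * r ^ j - 1, 2 * a * m * r ^ (k - 1 - j) - 1]
        (fwd (r ^ Suc j) (r ^ (k - Suc j)))"
      using fwd_block[of "r ^ j" "r ^ (k - 1 - j)" r] Suc.prems R_split[of j] r assms(5)
      by simp
    then show ?case
      using Suc bs_Suc[of j] cf_chain_append by simp
  qed
  have bwd_chain: "cf_chain (bwd (r ^ j)) (rev (?bs j)) (bwd 1)" if "j \<le> k" for j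
    using that
  proof (induction j)
    case (Suc j)
    have "cf_chain (bwd (r ^ Suc j)) [2 * a * m * r ^ (k - 1 - j) - 1, a * r ^ j - 1, 1] (bwd (r ^ j))"
      using bwd_block[of "r ^ j" "r ^ (k - 1 - j)" r] Suc.prems R_split[of j] r assms(5)
      by simp
    moreover have "cf_chain (bwd (r ^ j)) (rev (?bs j)) (bwd 1)"
      using Suc by simp
    moreover have "rev (?bs (Suc j)) = [2 * a * m * r ^ (k - 1 - j) - 1, a * r ^ j - 1, 1] @ rev (?bs j)"
      using bs_Suc[of j] Suc.prems by simp
    ultimately show ?case
      by (simp only: cf_chain_append)
  qed simp
  let ?init = "?bs k @ [1, A - 2, 1] @ rev (?bs k)" and ?last = "2 * m * A - 2"
  \<comment> \<open>Since \<open>m * s \<ge> 1\<close>, \<open>?last\<close> is at least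
    \<open>2 * a * m * R\<close>. The entries other than 1 are at most \<open>a * m * R - 1\<close>
    and, because \<open>r \<ge> 3\<close>, two thirds of \<open>a * m * R\<close> minus 1.\<close>
  have bs_set: "0 < c \<and> c < ?last" if "j \<le> k" "c \<in> set (?bs j)" for j c
    using that
  proof (induction j)
    case (Suc j)
    have j: "j < k" using Suc.prems(1) by simp
    have mA: "2 * (m * A) = 2 * (m * s) + 2 * (a * m * R)" by (simp add: A_def algebra_simps)
    have pows: "r ^ j \<ge> 1" "r ^ (k - 1 - j) \<ge> 1" using rpow by auto
    have "R \<ge> r ^ j" unfolding R_def using r j by (intro power_increasing) auto
    have a2: "a * r ^ j \<ge> 2 * 1" using assms(1) pows by (intro mult_mono) auto
    have "a * r ^ j \<le> a * R" using \<open>R \<ge> r ^ j\<close> assms(1) by simp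
    also have "a * R \<le> m * (a * R)" using assms(1,2) R by simp
    finally have a3: "a * r ^ j \<le> a * m * R" by (simp add: mult.commute mult.left_commute)
    have "1 * (r * r ^ (k - 1 - j)) \<le> r ^ j * (r * r ^ (k - 1 - j))"
      using pows r by (intro mult_right_mono) auto
    then have "R \<ge> r * r ^ (k - 1 - j)" using R_split(1)[OF j] by simp
    moreover have "r * r ^ (k - 1 - j) \<ge> 3 * r ^ (k - 1 - j)"
      using r pows by (intro mult_right_mono) auto
    ultimately have "R \<ge> 3 * r ^ (k - 1 - j)" by linarith
    then have m1: "a * m * R \<ge> a * m * (3 * r ^ (k - 1 - j))" using ms by (intro mult_left_mono) auto
    have m2: "a * m * r ^ (k - 1 - j) \<ge> 2 * 1" using ms pows by (intro mult_mono) auto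
    have "c \<in> set (?bs j) \<or> c = 1 \<or> c = a * r ^ j - 1 \<or> c = 2 * (a * m * r ^ (k - 1 - j)) - 1"
      using Suc.prems(2) unfolding bs_Suc[OF j] by auto
    then show ?case
      using Suc.IH j a2 a3 m1 m2 ms mA by (elim disjE) (auto simp: mult.assoc)
  qed simp
  have A2: "0 < A - 2" "A - 2 < ?last" "1 < ?last"
  proof -
    show "0 < A - 2" using AR R by simp
    moreover have "m * A \<ge> 1 * A" using assms(2) AR R by (intro mult_right_mono) auto
    ultimately show "A - 2 < ?last" "1 < ?last" using AR R by linarith+
  qed
  have init_set: "0 < c \<and> c < ?last" if "c \<in> set ?init" for c
    using that bs_set[of k c] A2 by auto
  have "cf_chain (fwd 1 R) (?bs k @ [1, A - 2, 1] @ rev (?bs k) @ [?last]) (fwd 1 R)"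
    using fwd_chain[of k] mid_block bwd_chain[of k] end_block
    by (intro cf_chain_append) (auto simp: R_def)
  \<comment> \<open>Regrouped so that the final entry stands apart, as
    \<open>cf_period_length_eq\<close> requires.\<close>
  then have loop: "cf_chain (fwd 1 R) (?init @ [?last]) (fwd 1 R)"
    by (simp only: append_assoc)
  have "c > 0" if "c \<in> set (?init @ [?last])" for c
  proof -
    have "c \<in> set ?init \<or> c = ?last" using that by auto
    then show ?thesis using init_set A2(3) by force
  qed
  then have "has_regular_cf (of_int (m * A - 1) + 1 / fwd 1 R) (periodic_cf (m * A - 1) (?init @ [?last]))"
    by (intro has_regular_cf_periodic[OF loop fwd_start(1)] ballI) simp_all
  then have cf: "has_regular_cf (sqrt (of_int D)) (periodic_cf (m * A - 1) (?init @ [?last]))"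
    using fwd_start(2) by (simp add: d_def)
  moreover have "cf_period_length D = 6 * k + 4"
  proof -
    \<comment> \<open>The strict bound isolates the last entry; the block has
      \<open>3 * k + 3 + 3 * k + 1\<close> entries.\<close>
    have "?last \<notin> set ?init" using init_set by blast
    then show ?thesis using cf_period_length_eq[OF cf] by simp
  qed
  ultimately show ?thesis
    by (simp add: A_def R_def)
qed

end
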